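(* For every integer $m\ge1$, \[\sum_{i=1}^m\frac1{z_i}-W_1<\log\rho(n_m)<\sum_{i=1}^m\frac1{z_i}-W_1+\frac1{2z_m}.\] Hence $\log\rho(n_m)=\sum_{i=1}^m\frac1{z_i}-W_1+O(1/z_m)$.
   Context: For an integer $n\ge2$, $\rho(n):=\sigma(n)/n$ with $\sigma(n)$ the sum of divisors of $n$. Consider all pairs $(q,k)$ with $q$ prime and $k\ge 1$ an integer, with value $z_{q,k}:=q+q^2+\cdots+q^k$. Enumerate these pairs as $(q_1,k_1),(q_2,k_2),\dots$ so that $z_i:=z_{q_i,k_i}$ is nondecreasing in $i$; if $z_{q,k}=z_{p,j}$ with $q>p$, then $(q,k)$ comes before $(p,j)$. For $m\ge1$ let $E_m$ be the set of the first $m$ pairs; for each prime $p$ let $k_p$ be the largest $k$ with $(p,k)\in E_m$ ($k_p=0$ if none), and $n_m:=\prod_p p^{k_p}$. Define $W_1:=\sum_{i=1}^\infty\left(\frac1{z_i}-\log\left(1+\frac1{z_i}\right)\right)$. *)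

theory Defs
  imports Complex_Main "HOL-Computational_Algebra.Primes" "HOL-Library.Infinite_Set"
    "HOL-Library.Landau_Symbols"
begin

definition sigma :: "nat \<Rightarrow> nat" where
  "sigma n = (\<Sum>d | d dvd n. d)"

definition rho :: "nat \<Rightarrow> real" where
  "rho n = real (sigma n) / real n"

definition prime_exp_pairs :: "(nat \<times> nat) set" where
  "prime_exp_pairs = {(q, k). prime q \<and> k \<ge> 1}"

fun zval :: "nat \<times> nat \<Rightarrow> nat" where
  "zval (q, k) = (\<Sum>j=1..k. q ^ j)"

text \<open>
  Enumerations are indexed from 1; the value at 0 is irrelevant. Since distinct pairs with
  equal value have distinct primes, the conditions determine the enumeration on positive indices.
\<close>

definition is_pair_enumeration :: "(nat \<Rightarrow> nat \<times> nat) \<Rightarrow> bool" where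
  "is_pair_enumeration e \<longleftrightarrow>
     bij_betw e {1..} prime_exp_pairs \<and>
     (\<forall>i\<ge>1. \<forall>j\<ge>i. zval (e i) \<le> zval (e j)) \<and>
     (\<forall>i\<ge>1. \<forall>j\<ge>1. zval (e i) = zval (e j) \<and> fst (e i) > fst (e j) \<longrightarrow> i < j)"

definition first_pairs :: "(nat \<Rightarrow> nat \<times> nat) \<Rightarrow> nat \<Rightarrow> (nat \<times> nat) set" where
  "first_pairs e m = e ` {1..m}"

definition max_exponent :: "(nat \<Rightarrow> nat \<times> nat) \<Rightarrow> nat \<Rightarrow> nat \<Rightarrow> nat" where
  "max_exponent e m p = Max (insert 0 {k. (p, k) \<in> first_pairs e m})"

text \<open>
  The product over all primes is restricted to the finitely many primes occurring among the
  first \<open>m\<close> pairs; all other primes have exponent 0.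
\<close>

definition n_of :: "(nat \<Rightarrow> nat \<times> nat) \<Rightarrow> nat \<Rightarrow> nat" where
  "n_of e m = (\<Prod>p \<in> fst ` first_pairs e m. p ^ max_exponent e m p)"

definition W1_term :: "(nat \<Rightarrow> nat \<times> nat) \<Rightarrow> nat \<Rightarrow> real" where
  "W1_term e i = 1 / real (zval (e i)) - ln (1 + 1 / real (zval (e i)))"

definition W1 :: "(nat \<Rightarrow> nat \<times> nat) \<Rightarrow> real" where
  "W1 e = (\<Sum>i. W1_term e (Suc i))"

lemma zval_ge:
  assumes "(q, k) \<in> prime_exp_pairs"
  shows "q \<le> zval (q, k)"
proof -
  have "q ^ 1 \<le> (\<Sum>j=1..k. q ^ j)"
    using assms by (intro member_le_sum) (simp_all add: prime_exp_pairs_def)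
  then show ?thesis by simp
qed

lemma zval_strict_mono:
  assumes "prime q" "j < k"
  shows "zval (q, j) < zval (q, k)"
proof -
  have "(\<Sum>i=1..j. q ^ i) < (\<Sum>i=1..k. q ^ i)"
    using assms by (intro sum_strict_mono2[where b = k]) (simp_all add: prime_gt_0_nat)
  then show ?thesis by simp
qed

text \<open>The ordering conditions are satisfiable.\<close>

lemma ex_pair_enumeration: "\<exists>e. is_pair_enumeration e"
proof -
  define f where "f = (\<lambda>x. zval x * (zval x + 1) + (zval x - fst x))"
  have less: "f x < f y" if "x \<in> prime_exp_pairs" "y \<in> prime_exp_pairs" "zval x < zval y" for x y
  proof -
    have "f x < (zval x + 1) * (zval x + 1)"
      by (simp add: f_def algebra_simps)
    also have "\<dots> \<le> zval y * (zval y + 1)"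
      using that by (intro mult_mono) auto
    also have "\<dots> \<le> f y" by (simp add: f_def)
    finally show ?thesis .
  qed
  have less': "f x < f y" if "x \<in> prime_exp_pairs" "y \<in> prime_exp_pairs" "zval x = zval y"
    "fst x > fst y" for x y
    using that zval_ge[of "fst x" "snd x"] by (simp add: f_def)
  have inj: "inj_on f prime_exp_pairs"
  proof (rule inj_onI)
    fix x y assume xy: "x \<in> prime_exp_pairs" "y \<in> prime_exp_pairs" "f x = f y"
    have z: "zval x = zval y"
      using less[of x y] less[of y x] xy by (metis less_irrefl linorder_less_linear)
    have "fst x = fst y"
      using less'[of x y] less'[of y x] xy z by (metis less_irrefl linorder_less_linear)
    moreover have "snd x = snd y"
      using zval_strict_mono[of "fst x" "snd x" "snd y"] zval_strict_mono[of "fst x" "snd y" "snd x"]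
        xy z calculation
      by (metis (no_types, lifting) case_prodD less_irrefl linorder_less_linear mem_Collect_eq
          prime_exp_pairs_def prod.collapse)
    ultimately show "x = y" by (simp add: prod_eq_iff)
  qed
  have "infinite prime_exp_pairs"
  proof
    assume "finite prime_exp_pairs"
    then have "finite (fst ` prime_exp_pairs)" by simp
    moreover have "{p::nat. prime p} \<subseteq> fst ` prime_exp_pairs"
    proof
      fix p :: nat assume "p \<in> {p. prime p}"
      then have "(p, 1) \<in> prime_exp_pairs" by (simp add: prime_exp_pairs_def)
      then show "p \<in> fst ` prime_exp_pairs" by (metis fst_conv imageI)
    qed
    ultimately show False using primes_infinite finite_subset by blast
  qed
  then have infS: "infinite (f ` prime_exp_pairs)"
    using inj finite_imageD by blast
  define S where "S = f ` prime_exp_pairs"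
  define e where "e = inv_into prime_exp_pairs f \<circ> enumerate S \<circ> (\<lambda>i. i - 1)"
  have bS: "bij_betw (enumerate S) UNIV S"
    using infS by (simp add: S_def bij_enumerate)
  have b1: "bij_betw (\<lambda>i::nat. i - 1) {1..} UNIV"
    by (rule bij_betw_byWitness[where f' = Suc]) auto
  have bij: "bij_betw e {1..} prime_exp_pairs"
    unfolding e_def
    by (intro bij_betw_trans[OF b1] bij_betw_trans[OF bS] bij_betw_inv_into)
       (use inj in \<open>simp add: S_def bij_betw_def\<close>)
  have mem: "e i \<in> prime_exp_pairs" if "i \<ge> 1" for i
    using bij that by (auto simp: bij_betw_def)
  have fe: "f (e i) = enumerate S (i - 1)" for i
    using enumerate_in_set[OF infS, of "i - 1"] by (simp add: e_def S_def f_inv_into_f)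
  have mono: "f (e i) \<le> f (e j) \<longleftrightarrow> i \<le> j" if "i \<ge> 1" "j \<ge> 1" for i j
  proof -
    have "infinite S" using infS by (simp add: S_def)
    then have "f (e i) \<le> f (e j) \<longleftrightarrow> i - 1 \<le> j - 1" by (simp add: fe)
    then show ?thesis using that by linarith
  qed
  have "is_pair_enumeration e"
    unfolding is_pair_enumeration_def
  proof (intro conjI allI impI)
    show "bij_betw e {1..} prime_exp_pairs" by (fact bij)
  next
    fix i j :: nat assume "1 \<le> i" "i \<le> j"
    then show "zval (e i) \<le> zval (e j)"
      using mono[of i j] less[of "e j" "e i"] mem[of i] mem[of j]
      by (meson le_trans linorder_not_less)
  next
    fix i j :: nat assume "1 \<le> i" "1 \<le> j" "zval (e i) = zval (e j) \<and> fst (e j) < fst (e i)"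
    then show "i < j"
      using mono[of j i] less'[of "e i" "e j"] mem[of i] mem[of j]
      by (meson linorder_not_less)
  qed
  then show ?thesis by blast
qed

end

theory Submission
  imports Defs
begin

text \<open>
  Since $\rho(p^k)/\rho(p^{k-1}) = 1 + 1/z_{p,k}$, the value $\log\rho(n_m)$ is the sum of
  $\log(1 + 1/z_i)$ over $i \le m$, so that $\log\rho(n_m) - \sum_{i\le m} 1/z_i + W_1$ is the
  tail after index $m$ of the series $W_1$. Its terms are positive and at most $1/(2z_i^2)$, and it
  remains to see that $\sum_{i>m} 1/z_i^2$ is less than $1/N$ by a constant factor, where
  $N = z_m$. The pairs with $k = 1$ are odd primes above $N$ and contribute at most $1/(2N)$.
  For those with $k \ge 2$ we use $1/z^2 \le (1/N)(1/z)$ and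
  $\sum_{k\ge2} 1/z_{q,k} \le \sum_q 1/(q^2-1) \le 1/3 + 1/4 = 7/12$. If $N \ge 6$, then $(2,2)$ with
  $z = 6$ is not in the tail, which lowers $7/12$ to $5/12$; if $N \le 5$, then
  $1/z^2 \le (1/6)(1/z)$.
\<close>

subsection \<open>Divisor sums\<close>

text \<open>Each divisor of \<open>a * b\<close> factors uniquely into a divisor of \<open>a\<close>
  and a divisor of \<open>b\<close>, so the divisor sum is a product of two sums.\<close>

lemma sigma_mult_coprime:
  assumes "coprime a b"
  shows "sigma (a * b) = sigma a * sigma b"
proof -
  have inj: "inj_on (\<lambda>(x, y). x * y) ({d. d dvd a} \<times> {d. d dvd b})"
  proof (rule inj_onI; clarsimp)
    fix x y x' y' assume d: "x dvd a" "y dvd b" "x' dvd a" "y' dvd b" and eq: "x * y = x' * y'"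
    \<comment> \<open>Since x divides x' y' and is coprime to y', it divides x'. By symmetry x = x',
      and likewise y = y'.\<close>
    have "coprime x y'" "coprime x' y" "coprime y x'" "coprime y' x"
      using assms d by (meson coprime_commute coprime_divisors)+
    then show "x = x' \<and> y = y'"
      using eq by (metis coprime_dvd_mult_left_iff coprime_dvd_mult_right_iff dvd_antisym
          dvd_triv_left dvd_triv_right)
  qed
  have "{d. d dvd a * b} = (\<lambda>(x, y). x * y) ` ({d. d dvd a} \<times> {d. d dvd b})"
    by (auto simp: image_iff intro: mult_dvd_mono dest: division_decomp)
  then have "sigma (a * b) = (\<Sum>(x, y)\<in>{d. d dvd a} \<times> {d. d dvd b}. x * y)"
    using inj by (simp add: sigma_def sum.reindex case_prod_unfold)
  also have "\<dots> = sigma a * sigma b"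
    by (simp add: sigma_def sum_product sum.cartesian_product)
  finally show ?thesis .
qed

lemma sigma_prime_power:
  assumes "prime p"
  shows "sigma (p ^ k) = (\<Sum>i\<le>k. p ^ i)"
proof -
  have "{d. d dvd p ^ k} = (\<lambda>i. p ^ i) ` {..k}"
    using divides_primepow_nat[OF assms] by auto
  moreover have "inj_on (\<lambda>i. p ^ i) {..k}"
    using prime_gt_1_nat[OF assms] by (simp add: inj_on_def)
  ultimately show ?thesis by (simp add: sigma_def sum.reindex)
qed

lemma rho_mult_coprime: "coprime a b \<Longrightarrow> rho (a * b) = rho a * rho b"
  by (simp add: rho_def sigma_mult_coprime)

lemma rho_1: "rho 1 = 1"
  by (simp add: rho_def sigma_def)

lemma rho_prod_coprime:
  assumes "finite A" "\<And>x y. x \<in> A \<Longrightarrow> y \<in> A \<Longrightarrow> x \<noteq> y \<Longrightarrow> coprime (f x) (f y)"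
  shows "rho (\<Prod>x\<in>A. f x) = (\<Prod>x\<in>A. rho (f x))"
  using assms
proof (induction A rule: finite_induct)
  case (insert a A)
  have "coprime (f a) (\<Prod>x\<in>A. f x)"
    using insert by (intro prod_coprime_right) auto
  then show ?case using insert by (simp add: rho_mult_coprime)
qed (use rho_1 in simp)

lemma zval_pos: "prime q \<Longrightarrow> k \<ge> 1 \<Longrightarrow> 0 < zval (q, k)"
  using zval_ge[of q k] prime_gt_0_nat[of q] by (simp add: prime_exp_pairs_def)

text \<open>This is the denominator of the ratio of consecutive values of \<rho>: raising the
  exponent from k to k + 1 multiplies \<rho> by \<sigma>(p^(k+1)) / (p \<sigma>(p^k)), whose
  numerator is 1 + z.\<close>

lemma zval_Suc_eq_mult_sigma:
  assumes "prime p"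
  shows "zval (p, Suc k) = p * sigma (p ^ k)"
proof -
  have "zval (p, Suc k) = (\<Sum>j\<le>k. p ^ Suc j)"
    by (simp del: power_Suc sum.cl_ivl_Suc flip: sum.shift_bounds_cl_Suc_ivl add: atMost_atLeast0)
  then show ?thesis
    by (simp add: sigma_prime_power[OF assms] sum_distrib_left)
qed

lemma rho_prime_power:
  assumes "prime p"
  shows "rho (p ^ k) = (\<Prod>j=1..k. 1 + 1 / real (zval (p, j)))"
proof (induction k)
  case (Suc k)
  have s: "sigma (p ^ Suc k) = sigma (p ^ k) + p ^ Suc k"
    by (simp add: sigma_prime_power[OF assms] del: power_Suc)
  have s1: "sigma (p ^ Suc k) = 1 + zval (p, Suc k)"
    by (simp add: sigma_prime_power[OF assms] atMost_atLeast0 sum.atLeast_Suc_atMost del: power_Suc)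
  have p: "real p > 0" using prime_gt_0_nat[OF assms] by simp
  have z: "real (zval (p, Suc k)) = p * real (sigma (p ^ k))"
    using zval_Suc_eq_mult_sigma[OF assms, of k] by (metis of_nat_mult)
  have "real (zval (p, Suc k)) > 0" using zval_pos[OF assms, of "Suc k"] by linarith
  moreover from this have "real (sigma (p ^ k)) > 0" using p z by (simp only: zero_less_mult_iff) auto
  ultimately have "rho (p ^ Suc k) = rho (p ^ k) * (1 + 1 / real (zval (p, Suc k)))"
    using p z unfolding rho_def s1 by (simp add: field_simps del: zval.simps)
  then show ?case using Suc by (simp del: zval.simps)
qed (use rho_1 in simp)

lemma ln_rho_prime_power:
  assumes "prime p"
  shows "ln (rho (p ^ k)) = (\<Sum>j=1..k. ln (1 + 1 / real (zval (p, j))))"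
proof -
  \<comment> \<open>This covers j = 0 too, where z = 0 and \<open>1 / 0 = 0\<close>.\<close>
  have "1 + 1 / real (zval (p, j)) \<noteq> 0" for j
    using divide_nonneg_nonneg[of 1 "real (zval (p, j))"] by linarith
  then show ?thesis
    unfolding rho_prime_power[OF assms] by (intro ln_prod) (auto simp del: zval.simps)
qed

subsection \<open>The factorization of \<open>n\<^sub>m\<close>\<close>

lemma enum_mem: "is_pair_enumeration e \<Longrightarrow> i \<ge> 1 \<Longrightarrow> e i \<in> prime_exp_pairs"
  by (auto simp: is_pair_enumeration_def bij_betw_def)

lemma enum_inj: "is_pair_enumeration e \<Longrightarrow> inj_on e {1..}"
  by (simp add: is_pair_enumeration_def bij_betw_def)

lemma enum_surj: "is_pair_enumeration e \<Longrightarrow> x \<in> prime_exp_pairs \<Longrightarrow> \<exists>i\<ge>1. e i = x"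
  unfolding is_pair_enumeration_def bij_betw_def by (metis atLeast_iff imageE)

lemma first_pairs_subset: "is_pair_enumeration e \<Longrightarrow> first_pairs e m \<subseteq> prime_exp_pairs"
  using enum_mem by (auto simp: first_pairs_def)

lemma enum_zval_mono:
  "is_pair_enumeration e \<Longrightarrow> 1 \<le> i \<Longrightarrow> i \<le> j \<Longrightarrow> zval (e i) \<le> zval (e j)"
  by (simp add: is_pair_enumeration_def)

text \<open>For a fixed prime, z increases strictly with the exponent, so smaller exponents come
  earlier in the enumeration.\<close>

lemma first_pairs_downward:
  assumes e: "is_pair_enumeration e" and pk: "(p, k) \<in> first_pairs e m" and j: "1 \<le> j" "j \<le> k"
  shows "(p, j) \<in> first_pairs e m"
proof (cases "j = k")
  case False
  obtain i where i: "1 \<le> i" "i \<le> m" "e i = (p, k)"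
    using pk by (auto simp: first_pairs_def)
  have "prime p" using enum_mem[OF e i(1)] i by (simp add: prime_exp_pairs_def)
  then have "(p, j) \<in> prime_exp_pairs" using j by (simp add: prime_exp_pairs_def)
  then obtain l where l: "1 \<le> l" "e l = (p, j)"
    using enum_surj[OF e] by force
  have "zval (e l) < zval (e i)"
    using zval_strict_mono[OF \<open>prime p\<close>, of j k] False j l i by simp
  then have "l \<le> m"
    using enum_zval_mono[OF e i(1), of l] i by linarith
  then show ?thesis using l by (force simp: first_pairs_def)
qed (use pk in simp)

text \<open>The exponents of each prime among the first m pairs form an initial interval. This lets
  a sum over the pairs be regrouped prime by prime.\<close>

lemma first_pairs_eq_Sigma:
  assumes e: "is_pair_enumeration e"
  shows "first_pairs e m = (SIGMA p:fst ` first_pairs e m. {1..max_exponent e m p})"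
proof -
  have fin: "finite {k. (p, k) \<in> first_pairs e m}" for p
    by (rule finite_subset[of _ "snd ` first_pairs e m"]) (force, simp add: first_pairs_def)
  have ge1: "1 \<le> k" if "(p, k) \<in> first_pairs e m" for p k
    using that first_pairs_subset[OF e] by (force simp: prime_exp_pairs_def)
  show ?thesis
  proof (intro equalityI subsetI)
    fix x assume x: "x \<in> first_pairs e m"
    then have "snd x \<le> max_exponent e m (fst x)"
      unfolding max_exponent_def using fin by (intro Max_ge) auto
    then show "x \<in> (SIGMA p:fst ` first_pairs e m. {1..max_exponent e m p})"
      using x ge1[of "fst x" "snd x"] by (cases x) force
  next
    fix x assume "x \<in> (SIGMA p:fst ` first_pairs e m. {1..max_exponent e m p})"
    then obtain p j where x: "x = (p, j)" "1 \<le> j" "j \<le> max_exponent e m p" by auto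
    \<comment> \<open>The maximum is 0 or an exponent that occurs; 1 \<le> j excludes 0.\<close>
    have "max_exponent e m p \<in> insert 0 {k. (p, k) \<in> first_pairs e m}"
      unfolding max_exponent_def using fin by (intro Max_in) auto
    then show "x \<in> first_pairs e m"
      using x first_pairs_downward[OF e] by auto
  qed
qed

lemma ln_rho_n_of:
  assumes e: "is_pair_enumeration e"
  shows "ln (rho (n_of e m)) = (\<Sum>i=1..m. ln (1 + 1 / real (zval (e i))))"
proof -
  define P where "P = fst ` first_pairs e m"
  have fin: "finite P" by (simp add: P_def first_pairs_def)
  have pr: "prime p" if "p \<in> P" for p
    using that first_pairs_subset[OF e] by (force simp: P_def prime_exp_pairs_def)
  have pos: "rho (p ^ k) > 0" if "prime p" for p k
    unfolding rho_prime_power[OF that]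
    by (intro prod_pos) (simp add: add_pos_nonneg del: zval.simps)
  have "(\<Sum>i=1..m. ln (1 + 1 / real (zval (e i)))) = (\<Sum>x\<in>first_pairs e m. ln (1 + 1 / real (zval x)))"
    unfolding first_pairs_def using enum_inj[OF e]
    by (subst sum.reindex) (auto elim: inj_on_subset)
  also have "\<dots> = (\<Sum>x\<in>(SIGMA p:P. {1..max_exponent e m p}). ln (1 + 1 / real (zval x)))"
    using first_pairs_eq_Sigma[OF e, of m] by (simp add: P_def)
  also have "\<dots> = (\<Sum>p\<in>P. \<Sum>k=1..max_exponent e m p. ln (1 + 1 / real (zval (p, k))))"
    using fin by (subst sum.Sigma) (auto simp: case_prod_unfold simp del: zval.simps)
  also have "\<dots> = (\<Sum>p\<in>P. ln (rho (p ^ max_exponent e m p)))"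
    using pr by (intro sum.cong refl) (simp add: ln_rho_prime_power del: zval.simps)
  also have "\<dots> = ln (\<Prod>p\<in>P. rho (p ^ max_exponent e m p))"
    using fin pr pos by (intro ln_prod[symmetric]) (auto simp: less_imp_neq[symmetric])
  also have "(\<Prod>p\<in>P. rho (p ^ max_exponent e m p)) = rho (n_of e m)"
    unfolding n_of_def P_def[symmetric] using fin pr
    by (intro rho_prod_coprime[symmetric]) (auto intro: primes_coprime coprime_power_left_iff)
  finally show ?thesis by simp
qed

subsection \<open>Sums over pairs\<close>

text \<open>With n = 2j + 1 one has n^2 - 1 = 4j(j + 1), so the terms telescope as (1/j - 1/(j +
  1))/4 from j = a on.\<close>

lemma sum_odd_inverse_le:
  fixes A :: "nat set"
  assumes "finite A" "a \<ge> 1" and A: "\<And>n. n \<in> A \<Longrightarrow> odd n \<and> n \<ge> 2 * a + 1"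
  shows "(\<Sum>n\<in>A. 1 / (real n ^ 2 - 1)) \<le> 1 / (4 * real a)"
proof -
  define B where "B = (\<lambda>n. n div 2) ` A"
  define b where "b = Suc (Max (insert a B))"
  have finB: "finite B" using assms by (simp add: B_def)
  have AB: "A = (\<lambda>j. 2 * j + 1) ` B"
    using A by (force simp: B_def image_image)
  have inj: "inj_on (\<lambda>j::nat. 2 * j + 1) B" by (simp add: inj_on_def)
  have Bsub: "B \<subseteq> {a..<b}"
    using A finB Max_ge[of "insert a B"] by (fastforce simp: B_def b_def less_Suc_eq_le)
  have ab: "a \<le> b" using finB by (simp add: b_def le_SucI)
  have tele: "(\<Sum>j=a..<a+k. 1 / (real (2 * j + 1) ^ 2 - 1)) = (1 / real a - 1 / real (a + k)) / 4" for k
  proof (induction k)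
    case (Suc k)
    have pos: "real (a + k) > 0" using \<open>a \<ge> 1\<close> by simp
    have "real (2 * (a + k) + 1) ^ 2 - 1 = 4 * (real (a + k) * (real (a + k) + 1))"
      by (simp add: power2_eq_square algebra_simps)
    also have "1 / \<dots> = (1 / real (a + k) - 1 / (real (a + k) + 1)) / 4"
      using pos by (simp add: divide_simps)
    finally show ?case using Suc by (simp add: diff_divide_distrib)
  qed simp
  have "(\<Sum>n\<in>A. 1 / (real n ^ 2 - 1)) = (\<Sum>j\<in>B. 1 / (real (2 * j + 1) ^ 2 - 1))"
    unfolding AB using inj by (subst sum.reindex) (auto simp: o_def)
  also have "\<dots> \<le> (\<Sum>j=a..<b. 1 / (real (2 * j + 1) ^ 2 - 1))"
    using Bsub by (intro sum_mono2) (auto simp: one_le_power)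
  also have "\<dots> = (1 / real a - 1 / real b) / 4"
    using tele[of "b - a"] ab by simp
  also have "\<dots> \<le> 1 / (4 * real a)" by (simp add: field_simps)
  finally show ?thesis .
qed

lemma zval_ge_square:
  assumes "k \<ge> 2"
  shows "q ^ 2 + q \<le> zval (q, k)"
proof -
  have "(\<Sum>j\<in>{1, 2}. q ^ j) \<le> (\<Sum>j=1..k. q ^ j)"
    using assms by (intro sum_mono2) auto
  then show ?thesis by simp
qed

text \<open>As q divides z, a prime value must be q itself, and k \<ge> 2 would make z exceed q. It
  follows that the tail has no prime pair of value exactly N.\<close>

lemma zval_eq_prime:
  assumes x: "x \<in> prime_exp_pairs" and p: "prime p" "zval x = p"
  shows "x = (p, 1)"
proof -
  obtain q k where xq: "x = (q, k)" "prime q" "k \<ge> 1" using x by (auto simp: prime_exp_pairs_def)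
  have "q dvd zval (q, k)" by (auto intro!: dvd_sum)
  then have "q = p" using p xq by (metis primes_dvd_imp_eq)
  moreover have "\<not> k \<ge> 2"
    using zval_ge_square[of k q] calculation p xq prime_gt_0_nat[of q] by auto
  ultimately show ?thesis using xq by auto
qed

text \<open>Exponent 1 would make 6 prime, and q \<ge> 3 with k \<ge> 2 gives z \<ge> 12. This
  serves to keep (2, 2) out of the tail when N = 6.\<close>

lemma zval_eq_6:
  assumes x: "x \<in> prime_exp_pairs" and z: "zval x = 6"
  shows "x = (2, 2)"
proof -
  obtain q k where xq: "x = (q, k)" "prime q" "k \<ge> 1" using x by (auto simp: prime_exp_pairs_def)
  have k: "k \<ge> 2"
  proof (rule ccontr)
    assume "\<not> k \<ge> 2"
    then have "k = 1" using xq by simp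
    then have "prime (6::nat)" using xq z by simp
    then show False using prime_nat_iff[of 6] by (auto dest: spec[of _ 2])
  qed
  have "q = 2"
  proof (rule ccontr)
    assume "q \<noteq> 2"
    then have "q \<ge> 3" using prime_ge_2_nat[OF xq(2)] by simp
    then have "q ^ 2 \<ge> 3 ^ 2" by (intro power_mono) auto
    then show False using zval_ge_square[OF k, of q] xq z by simp
  qed
  moreover have "zval (2, 2) = 6" by (simp add: numeral_2_eq_2)
  ultimately show ?thesis
    using zval_strict_mono[of 2 2 k] xq z k by fastforce
qed

text \<open>The two largest powers alone give z \<ge> q^(k-1) (q + 1). The reciprocals of these
  bounds form a geometric series of ratio 1/q with sum 1/((q - 1)(q + 1)).\<close>

lemma sum_inverse_zval_fixed_prime:
  assumes "q \<ge> 2"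
  shows "(\<Sum>k=2..K. 1 / real (zval (q, k))) \<le> 1 / (real q ^ 2 - 1)"
proof -
  have q: "real q \<ge> 2" using assms by simp
  then have q2: "real q ^ 2 - 1 > 0" by (simp add: power2_eq_square algebra_simps less_1_mult)
  have geo: "(\<Sum>k=2..Suc n. 1 / (real q ^ (k - 1) * (real q + 1))) = (1 - 1 / real q ^ n) / (real q ^ 2 - 1)" for n
  proof (induction n)
    case (Suc n)
    have "(1 - 1 / real q ^ Suc n) / (real q ^ 2 - 1) - (1 - 1 / real q ^ n) / (real q ^ 2 - 1)
        = (1 / real q ^ n - 1 / real q ^ Suc n) / (real q ^ 2 - 1)"
      by (simp add: diff_divide_distrib)
    also have "1 / real q ^ n - 1 / real q ^ Suc n = (real q - 1) / real q ^ Suc n"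
      using q by (simp add: field_simps)
    also have "(real q - 1) / real q ^ Suc n / (real q ^ 2 - 1) = 1 / (real q ^ Suc n * (real q + 1))"
    proof -
      have "real q ^ 2 - 1 = (real q - 1) * (real q + 1)"
        by (simp add: power2_eq_square algebra_simps)
      then show ?thesis using q by simp
    qed
    finally show ?case using Suc by simp
  qed simp
  \<comment> \<open>The closed form \<open>geo\<close> has upper end \<open>Suc n\<close>; extending
    the range makes it apply for every K, including K = 0.\<close>
  have "(\<Sum>k=2..K. 1 / real (zval (q, k))) \<le> (\<Sum>k=2..Suc K. 1 / real (zval (q, k)))"
    by (intro sum_mono2) (auto simp del: zval.simps)
  also have "\<dots> \<le> (\<Sum>k=2..Suc K. 1 / (real q ^ (k - 1) * (real q + 1)))"
  proof (intro sum_mono divide_left_mono)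
    fix k assume k: "k \<in> {2..Suc K}"
    have "(\<Sum>j\<in>{k - 1, k}. q ^ j) \<le> zval (q, k)"
      unfolding zval.simps using k by (intro sum_mono2) auto
    moreover have "(\<Sum>j\<in>{k - 1, k}. q ^ j) = q ^ (k - 1) * (q + 1)"
      using k by (cases k) auto
    ultimately have le: "q ^ (k - 1) * (q + 1) \<le> zval (q, k)" by simp
    then show "real q ^ (k - 1) * (real q + 1) \<le> real (zval (q, k))"
      by (simp only: of_nat_mult of_nat_power of_nat_add of_nat_1 flip: of_nat_le_iff[where 'a = real])
    have "0 < q ^ (k - 1) * (q + 1)" using assms by simp
    then have "0 < real (zval (q, k))" using le by linarith
    moreover have "0 < real q ^ (k - 1) * (real q + 1)" using q by (simp add: add_pos_pos)
    ultimately show "0 < real (zval (q, k)) * (real q ^ (k - 1) * (real q + 1))" by (rule mult_pos_pos)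
  qed simp
  also have "\<dots> \<le> 1 / (real q ^ 2 - 1)"
    unfolding geo using q2 by (intro divide_right_mono) auto
  finally show ?thesis .
qed

lemma sum_inverse_zval_le:
  assumes fin: "finite B" and B: "B \<subseteq> prime_exp_pairs" "\<And>x. x \<in> B \<Longrightarrow> snd x \<ge> 2"
  shows "(\<Sum>x\<in>B. 1 / real (zval x)) \<le> 7 / 12"
proof -
  define Q where "Q = fst ` B"
  define K where "K = Max (insert 0 (snd ` B))"
  have finQ: "finite Q" using fin by (simp add: Q_def)
  have Q: "prime q" if "q \<in> Q" for q using that B by (auto simp: Q_def prime_exp_pairs_def)
  have "snd x \<le> K" if "x \<in> B" for x
    unfolding K_def using fin that by (intro Max_ge) auto
  then have sub: "B \<subseteq> Q \<times> {2..K}" using B(2) by (force simp: Q_def)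
  have nn: "0 \<le> 1 / (real q ^ 2 - 1)" if "q \<in> Q" for q
    using prime_ge_2_nat[OF Q[OF that]] by simp
  have "(\<Sum>x\<in>B. 1 / real (zval x)) \<le> (\<Sum>x\<in>Q \<times> {2..K}. 1 / real (zval x))"
    using sub finQ by (intro sum_mono2) (auto simp del: zval.simps)
  also have "\<dots> = (\<Sum>q\<in>Q. \<Sum>k=2..K. 1 / real (zval (q, k)))"
    by (simp add: sum.cartesian_product case_prod_unfold del: zval.simps)
  also have "\<dots> \<le> (\<Sum>q\<in>Q. 1 / (real q ^ 2 - 1))"
    using Q prime_ge_2_nat by (intro sum_mono sum_inverse_zval_fixed_prime) auto
  \<comment> \<open>Adjoining 2 allows the term 1/3 to be split off whether or not 2 lies in Q. The
    rest are odd primes, bounded by 1/4.\<close>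
  also have "\<dots> \<le> (\<Sum>q\<in>insert 2 (Q - {2}). 1 / (real q ^ 2 - 1))"
    using finQ nn by (intro sum_mono2) auto
  also have "\<dots> = 1 / 3 + (\<Sum>q\<in>Q - {2}. 1 / (real q ^ 2 - 1))"
    using finQ by (subst sum.insert) auto
  also have "(\<Sum>q\<in>Q - {2}. 1 / (real q ^ 2 - 1)) \<le> 1 / (4 * real 1)"
  proof (rule sum_odd_inverse_le)
    fix q assume "q \<in> Q - {2}"
    then have "prime q" "q > 2" using Q prime_ge_2_nat[of q] by force+
    then show "odd q \<and> q \<ge> 2 * 1 + 1" using prime_odd_nat by auto
  qed (use finQ in auto)
  finally show ?thesis by simp
qed

text \<open>Here y stands for the m-th pair and A for a finite piece of the tail after it. The
  constant is 36/72 from exponent 1 plus 35/72 from exponents at least 2; being below 1, it leaves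
  room for strictness in the limit.\<close>

lemma sum_inverse_zval_square_le:
  assumes fin: "finite A" and A: "A \<subseteq> prime_exp_pairs"
    and y: "y \<in> prime_exp_pairs" "y \<notin> A" and ge: "\<And>x. x \<in> A \<Longrightarrow> zval y \<le> zval x"
  shows "(\<Sum>x\<in>A. 1 / real (zval x) ^ 2) \<le> 71 / (72 * real (zval y))"
proof -
  define N where "N = zval y"
  define A1 where "A1 = {x \<in> A. snd x = 1}"
  define A2 where "A2 = {x \<in> A. snd x \<ge> 2}"
  have fins: "finite A1" "finite A2" using fin by (auto simp: A1_def A2_def)
  have split: "A = A1 \<union> A2" "A1 \<inter> A2 = {}"
    using A by (force simp: A1_def A2_def prime_exp_pairs_def)+
  have N2: "N \<ge> 2"
    using y zval_ge[of "fst y" "snd y"] prime_ge_2_nat[of "fst y"]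
    by (auto simp: N_def prime_exp_pairs_def)
  have "(\<Sum>x\<in>A1. 1 / real (zval x) ^ 2) = (\<Sum>p\<in>fst ` A1. 1 / real p ^ 2)"
    by (subst sum.reindex) (auto simp: A1_def inj_on_def intro!: sum.cong)
  also have "\<dots> \<le> (\<Sum>p\<in>fst ` A1. 1 / (real p ^ 2 - 1))"
  proof (rule sum_mono)
    fix p assume "p \<in> fst ` A1"
    then have "p \<ge> 2" using A by (auto simp: A1_def prime_exp_pairs_def intro: prime_ge_2_nat)
    then have "real p ^ 2 \<ge> 2 ^ 2" by (intro power_mono) auto
    then have "real p ^ 2 - 1 > 0" "real p ^ 2 - 1 \<le> real p ^ 2" by simp_all
    then show "1 / real p ^ 2 \<le> 1 / (real p ^ 2 - 1)" by (intro frac_le) simp_all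
  qed
  \<comment> \<open>An odd p > N is at least N + 1 for even N and N + 2 for odd N, which is
    \<open>2 * ((N + 1) div 2) + 1\<close> in both cases.\<close>
  also have "\<dots> \<le> 1 / (4 * real ((N + 1) div 2))"
  proof (rule sum_odd_inverse_le)
    fix p assume "p \<in> fst ` A1"
    then have p: "(p, 1) \<in> A" by (auto simp: A1_def)
    then have pr: "prime p" using A by (auto simp: prime_exp_pairs_def)
    have "N \<le> p" using ge[OF p] by (simp add: N_def)
    \<comment> \<open>Equality would force y = (p, 1), which lies in A.\<close>
    moreover have "N \<noteq> p" using zval_eq_prime[OF y(1) pr] p y(2) by (auto simp: N_def)
    ultimately have "N < p" by simp
    moreover have "odd p" using prime_odd_nat[OF pr] \<open>N < p\<close> N2 by auto
    ultimately show "odd p \<and> 2 * ((N + 1) div 2) + 1 \<le> p" by (auto elim!: oddE)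
  qed (use fins N2 in auto)
  also have "\<dots> \<le> 1 / (2 * real N)"
    using N2 by (intro divide_left_mono) auto
  finally have s1: "(\<Sum>x\<in>A1. 1 / real (zval x) ^ 2) \<le> 1 / (2 * real N)" .
  have A2: "A2 \<subseteq> prime_exp_pairs" "\<And>x. x \<in> A2 \<Longrightarrow> snd x \<ge> 2" using A by (auto simp: A2_def)
  \<comment> \<open>One of the two factors 1/z is bounded by 1/M. The choice is M = N if N \<ge> 6
    and M = 6 otherwise.\<close>
  have sq: "(\<Sum>x\<in>A2. 1 / real (zval x) ^ 2) \<le> 1 / real M * (\<Sum>x\<in>A2. 1 / real (zval x))"
    if "M > 0" "\<And>x. x \<in> A2 \<Longrightarrow> M \<le> zval x" for M
    unfolding sum_distrib_left
  proof (rule sum_mono)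
    fix x assume x: "x \<in> A2"
    have "0 < real M" "real M \<le> real (zval x)" using that x by auto
    then show "1 / real (zval x) ^ 2 \<le> 1 / real M * (1 / real (zval x))"
      by (simp add: power2_eq_square frac_le)
  qed
  \<comment> \<open>The second case dictates 35/72: (1/6)(7/12) = 7/72, and N \<le> 5 gives 7/72
    \<le> 35/(72N). The first case yields only 30/(72N).\<close>
  have s2: "(\<Sum>x\<in>A2. 1 / real (zval x) ^ 2) \<le> 35 / (72 * real N)"
  proof (cases "N \<ge> 6")
    case True
    have z22: "zval (2, 2) = 6" by (simp add: numeral_2_eq_2)
    have notin: "(2, 2) \<notin> A2"
    proof
      assume a: "(2, 2) \<in> A2"
      then have "zval y = 6" using ge[of "(2, 2)"] True z22 by (simp add: A2_def N_def del: zval.simps)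
      then show False using zval_eq_6[OF y(1)] y(2) a by (simp add: A2_def)
    qed
    \<comment> \<open>The bound 7/12 holds even with (2, 2) adjoined; removing its term 1/6 leaves
      5/12.\<close>
    have "(\<Sum>x\<in>insert (2, 2) A2. 1 / real (zval x)) \<le> 7 / 12"
      using fins A2 by (intro sum_inverse_zval_le) (auto simp: prime_exp_pairs_def)
    then have "(\<Sum>x\<in>A2. 1 / real (zval x)) \<le> 5 / 12"
      using notin fins z22 by (simp del: zval.simps)
    then have "1 / real N * (\<Sum>x\<in>A2. 1 / real (zval x)) \<le> 1 / real N * (5 / 12)"
      by (intro mult_left_mono) auto
    moreover have "1 / real N * (5 / 12) \<le> 35 / (72 * real N)"
      using N2 by (simp add: field_simps)
    ultimately show ?thesis
      using sq[of N] N2 ge by (force simp: A2_def N_def simp del: zval.simps)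
  next
    case False
    have "6 \<le> zval x" if "x \<in> A2" for x
    proof -
      obtain q k where x: "x = (q, k)" by (cases x)
      have "prime q" "k \<ge> 2" using that A2 x by (auto simp: prime_exp_pairs_def)
      moreover have "2 ^ 2 \<le> q ^ 2" using prime_ge_2_nat[OF \<open>prime q\<close>] by (intro power_mono) auto
      ultimately show ?thesis
        using zval_ge_square[of k q] prime_ge_2_nat[of q] x by (simp del: zval.simps)
    qed
    then have "(\<Sum>x\<in>A2. 1 / real (zval x) ^ 2) \<le> 1 / real 6 * (\<Sum>x\<in>A2. 1 / real (zval x))"
      by (intro sq) auto
    also have "\<dots> \<le> 1 / real 6 * (7 / 12)"
      using fins A2 by (intro mult_left_mono sum_inverse_zval_le) auto
    also have "\<dots> \<le> 35 / (72 * real N)"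
      using N2 False by (simp add: field_simps)
    finally show ?thesis .
  qed
  have "(\<Sum>x\<in>A. 1 / real (zval x) ^ 2)
      = (\<Sum>x\<in>A1. 1 / real (zval x) ^ 2) + (\<Sum>x\<in>A2. 1 / real (zval x) ^ 2)"
    unfolding split(1) using fins split(2) by (rule sum.union_disjoint)
  also have "\<dots> \<le> 1 / (2 * real N) + 35 / (72 * real N)" using s1 s2 by (rule add_mono)
  also have "\<dots> = 71 / (72 * real N)" using N2 by (simp add: field_simps)
  finally show ?thesis by (simp add: N_def)
qed

subsection \<open>The series \<open>W\<^sub>1\<close>\<close>

text \<open>The derivative of ln(1 + t) - t + t^2/2 is t^2/(1 + t), which is nonnegative for t \<ge>
  0.\<close>

lemma diff_ln_le_square:
  fixes x :: real
  assumes "x \<ge> 0"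
  shows "x - ln (1 + x) \<le> x ^ 2 / 2"
proof -
  let ?f = "\<lambda>t::real. ln (1 + t) - t + t ^ 2 / 2"
  have "?f 0 \<le> ?f x"
  proof (rule DERIV_nonneg_imp_nondecreasing[OF assms])
    fix t :: real assume t: "0 \<le> t" "t \<le> x"
    have "(?f has_real_derivative (1 / (1 + t) - 1 + t)) (at t)"
      using t by (auto intro!: derivative_eq_intros)
    moreover have "1 / (1 + t) - 1 + t = t ^ 2 / (1 + t)"
      using t by (simp add: field_simps power2_eq_square)
    ultimately show "\<exists>y. (?f has_real_derivative y) (at t) \<and> 0 \<le> y"
      using t by (intro exI[of _ "1 / (1 + t) - 1 + t"]) simp
  qed
  then show ?thesis by simp
qed

lemma W1_term_pos:
  assumes "is_pair_enumeration e" "i \<ge> 1"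
  shows "0 < W1_term e i"
proof -
  have "0 < zval (e i)"
    using enum_mem[OF assms] zval_pos by (auto simp: prime_exp_pairs_def simp del: zval.simps)
  then show ?thesis
    using ln_add_one_self_less_self[of "1 / real (zval (e i))"] by (simp add: W1_term_def)
qed

text \<open>The bound is uniform in n, so it yields both the convergence of the series and an
  estimate of its tails.\<close>

lemma sum_W1_term_le:
  assumes e: "is_pair_enumeration e" and m: "m \<ge> 1"
  shows "(\<Sum>i<n. W1_term e (Suc (i + m))) \<le> 71 / (144 * real (zval (e m)))"
proof -
  define A where "A = (\<lambda>i. e (Suc (i + m))) ` {..<n}"
  have inj: "inj_on (\<lambda>i. e (Suc (i + m))) {..<n}"
    by (rule inj_onI) (use inj_onD[OF enum_inj[OF e]] in fastforce)
  have notin: "e m \<notin> A"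
    using inj_onD[OF enum_inj[OF e], of m] m by (fastforce simp: A_def)
  have "(\<Sum>i<n. W1_term e (Suc (i + m))) \<le> (\<Sum>i<n. (1 / real (zval (e (Suc (i + m)))) ^ 2) / 2)"
    unfolding W1_term_def
    using diff_ln_le_square[of "1 / real (zval (e (Suc (i + m))))" for i]
    by (intro sum_mono) (simp add: power_divide)
  also have "\<dots> = (\<Sum>x\<in>A. 1 / real (zval x) ^ 2) / 2"
    unfolding A_def sum.reindex[OF inj] by (simp only: sum_divide_distrib o_def)
  also have "(\<Sum>x\<in>A. 1 / real (zval x) ^ 2) \<le> 71 / (72 * real (zval (e m)))"
    using enum_mem[OF e] enum_zval_mono[OF e m] m notin
    by (intro sum_inverse_zval_square_le) (auto simp: A_def)
  finally show ?thesis by simp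
qed

theorem theorem4:
  fixes e :: "nat \<Rightarrow> nat \<times> nat"
  assumes "is_pair_enumeration e"
  shows "summable (\<lambda>i. W1_term e (Suc i)) \<and>
         (\<forall>m\<ge>1.
           (\<Sum>i=1..m. 1 / real (zval (e i))) - W1 e < ln (rho (n_of e m)) \<and>
           ln (rho (n_of e m)) < (\<Sum>i=1..m. 1 / real (zval (e i))) - W1 e + 1 / (2 * real (zval (e m)))) \<and>
         (\<lambda>m. ln (rho (n_of e m)) - ((\<Sum>i=1..m. 1 / real (zval (e i))) - W1 e))
           \<in> O(\<lambda>m. 1 / real (zval (e m)))"
proof -
  note e = assms
  define S where "S m = (\<Sum>i=1..m. 1 / real (zval (e i)))" for m
  define w where "w i = W1_term e (Suc i)" for i
  have wpos: "0 < w i" for i by (simp add: w_def W1_term_pos[OF e])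
  have part: "(\<Sum>i<n. w (i + m)) \<le> 71 / (144 * real (zval (e m)))" if "m \<ge> 1" for n m
    unfolding w_def by (rule sum_W1_term_le[OF e that])
  \<comment> \<open>The uniform bound needs m \<ge> 1, so convergence is first shown with one term
    dropped.\<close>
  have "summable (\<lambda>i. w (i + 1))"
    using wpos part[of 1] by (intro summableI_nonneg_bounded) (auto intro: less_imp_le)
  then have sm: "summable w" using summable_iff_shift by blast
  have smm: "summable (\<lambda>i. w (i + m))" for m using sm summable_iff_shift by blast
  \<comment> \<open>Since \<open>w\<close> is indexed from 0, its first m terms belong to the pairs
    1 to m, and their sum is \<Sum> 1/z minus the logarithm. What remains of W1 is the tail from
    pair m + 1 on.\<close>
  have diff: "ln (rho (n_of e m)) = S m - W1 e + (\<Sum>i. w (i + m))" for m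
  proof -
    have "W1 e = (\<Sum>i. w (i + m)) + (\<Sum>i<m. w i)"
      using suminf_split_initial_segment[OF sm, of m] by (simp add: W1_def flip: w_def)
    moreover have "(\<Sum>i<m. w i) = (\<Sum>i=1..m. W1_term e i)"
      unfolding w_def using sum.atLeast1_atMost_eq[of "W1_term e" m] by simp
    moreover have "(\<Sum>i=1..m. W1_term e i) = S m - ln (rho (n_of e m))"
      by (simp add: W1_term_def S_def ln_rho_n_of[OF e] sum_subtractf)
    ultimately show ?thesis by simp
  qed
  have lower: "0 < (\<Sum>i. w (i + m))" for m using smm wpos by (intro suminf_pos)
  have upper: "(\<Sum>i. w (i + m)) < 1 / (2 * real (zval (e m)))" if m: "m \<ge> 1" for m
  proof -
    have z: "0 < zval (e m)"
      using enum_mem[OF e m] zval_pos by (auto simp: prime_exp_pairs_def simp del: zval.simps)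
    have "(\<Sum>i. w (i + m)) \<le> 71 / (144 * real (zval (e m)))"
      using smm part[OF m] by (intro suminf_le_const)
    \<comment> \<open>Passing to the limit preserves only \<le>; strictness comes from 71/144 <
      72/144.\<close>
    also have "\<dots> < 1 / (2 * real (zval (e m)))" using z by (simp add: field_simps)
    finally show ?thesis .
  qed
  have "(\<lambda>m. ln (rho (n_of e m)) - (S m - W1 e)) \<in> O(\<lambda>m. 1 / real (zval (e m)))"
  \<comment> \<open>For m \<ge> 1 the difference is the tail, which lies between 0 and 1/(2z); hence
    the constant 1/2.\<close>
  proof (rule bigoI[of _ "1 / 2"])
    show "\<forall>\<^sub>F m in sequentially. norm (ln (rho (n_of e m)) - (S m - W1 e))
        \<le> 1 / 2 * norm (1 / real (zval (e m)))"
      using eventually_ge_at_top[of 1]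
    proof eventually_elim
      case (elim m)
      then show ?case using lower[of m] upper[of m] by (simp add: diff)
    qed
  qed
  then show ?thesis
    using sm lower upper unfolding S_def[symmetric] w_def[symmetric] diff by auto
qed

end
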